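(* Let $k\ge 2$ be a real number and let $f(z)=z+a_2z^2+a_3z^3+\cdots$ be an element of $R_k$. Then for every integer $n\ge2$, $$|a_n|\le \frac{1}{(n-1)!}\prod_{\nu=0}^{n-2}(k+\nu).$$
   Context: $\mathbb{D}=\{z\in\mathbb{C}:|z|<1\}$. $\mathcal{A}$ is the family of functions $f$ analytic in $\mathbb{D}$ with Taylor expansion $f(z)=z+a_2z^2+a_3z^3+\cdots$. $\mathcal{P}$ is the family of functions $p(z)=1+c_1z+c_2z^2+\cdots$ analytic in $\mathbb{D}$ such that $p(z)=\frac{1+\phi(z)}{1-\phi(z)}$ for some analytic $\phi:\mathbb{D}\to\mathbb{D}$ with $\phi(0)=0$ (equivalently, $p(0)=1$ and $\operatorname{Re}p(z)>0$ in $\mathbb{D}$). For real $k\ge2$, $R_k$ (functions of bounded radius rotation) is the class of $f\in\mathcal{A}$ for which there exist $p_1,p_2\in\mathcal{P}$ with $$z\frac{f'(z)}{f(z)}=\left(\frac{k}{4}+\frac12\right)p_1(z)-\left(\frac{k}{4}-\frac12\right)p_2(z),\qquad z\in\mathbb{D},$$ where the left-hand side is understood to take the value $1$ at $z=0$. *)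

theory Defs
  imports "HOL-Complex_Analysis.Complex_Analysis"
begin

abbreviation unit_disc :: "complex set" ("\<D>") where
  "\<D> \<equiv> ball 0 1"

definition class_A :: "(complex \<Rightarrow> complex) set" where
  "class_A = {f. f holomorphic_on \<D> \<and>
     (\<exists>a. a 0 = 0 \<and> a 1 = 1 \<and> (\<forall>z\<in>\<D>. (\<lambda>n. a n * z ^ n) sums f z))}"

definition class_P :: "(complex \<Rightarrow> complex) set" where
  "class_P = {p. p holomorphic_on \<D> \<and> p 0 = 1 \<and>
     (\<exists>\<phi>. \<phi> holomorphic_on \<D> \<and> \<phi> ` \<D> \<subseteq> \<D> \<and> \<phi> 0 = 0 \<and>
          (\<forall>z\<in>\<D>. p z = (1 + \<phi> z) / (1 - \<phi> z)))}"

(* The removable singularity of z f'(z) / f(z) at 0 is filled with the value 1. *)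
definition log_deriv_quotient :: "(complex \<Rightarrow> complex) \<Rightarrow> complex \<Rightarrow> complex" where
  "log_deriv_quotient f z = (if z = 0 then 1 else z * (deriv f z / f z))"

(* For the quotient z f'(z) / f(z) to be defined on the disc, f must not vanish there except
   at 0. This is implicit in the defining identity and is stated because x / 0 = 0 in HOL.
   The class is meant for k at least 2. *)
definition class_R :: "real \<Rightarrow> (complex \<Rightarrow> complex) set" where
  "class_R k = {f \<in> class_A. (\<forall>z\<in>\<D> - {0}. f z \<noteq> 0) \<and>
     (\<exists>p1\<in>class_P. \<exists>p2\<in>class_P. \<forall>z\<in>\<D>.
        log_deriv_quotient f z =
          complex_of_real (k / 4 + 1 / 2) * p1 z - complex_of_real (k / 4 - 1 / 2) * p2 z)}"

end

(* Writing z f'(z) / f(z) = 1 + q_1 z + q_2 z^2 + ..., Caratheodory's bound 2 for the coefficients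
   of functions in class P gives |q_m| <= 2 (k/4 + 1/2) + 2 (k/4 - 1/2) = k. Comparing coefficients
   in z f' = q f yields (n - 1) a_n = q_(n-1) a_1 + ... + q_1 a_(n-1), hence
   (n - 1) |a_n| <= k (|a_1| + ... + |a_(n-1)|), and the claimed bounds solve this recursion
   with equality.

   For Caratheodory's bound, averaging p over the rotations by n-th roots of unity keeps
   Re p > 0 and the n-th coefficient c_n while killing c_1, ..., c_(n-1); then (p - 1) / (p + 1)
   is bounded by 1 and has n-th coefficient c_n / 2. *)
theory Submission
  imports Defs
begin

section \<open>Cauchy estimates on the disc and the Cayley transform\<close>

text \<open>Cauchy's inequality on the circle of radius \<open>r < 1\<close> bounds the coefficient
  by \<open>B / r ^ n\<close>; then \<open>r\<close> tends to 1 from the left.\<close>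

lemma fps_nth_bounded_on_disc:
  assumes "f holomorphic_on ball 0 1" "f has_fps_expansion F"
    and "\<And>z. z \<in> ball 0 1 \<Longrightarrow> norm (f z) \<le> B"
  shows "norm (fps_nth F n) \<le> B"
proof -
  have "norm (fps_nth F n) * r ^ n \<le> B" if r: "0 < r" "r < 1" for r :: real
  proof -
    have sub: "cball 0 r \<subseteq> (ball 0 1 :: complex set)"
      using r by auto
    have "norm ((deriv ^^ n) f 0) \<le> fact n * B / r ^ n"
    proof (rule Cauchy_inequality)
      show "f holomorphic_on ball 0 r"
        using assms(1) sub by (meson ball_subset_cball holomorphic_on_subset order_trans)
      show "continuous_on (cball 0 r) f"
        using assms(1) sub by (meson holomorphic_on_imp_continuous_on holomorphic_on_subset)
    qed (use r assms(3) in auto)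
    then show ?thesis
      using r by (simp add: fps_nth_fps_expansion[OF assms(2)] norm_divide field_simps)
  qed
  then have "eventually (\<lambda>r. norm (fps_nth F n) * r ^ n \<le> B) (at_left 1)"
    using eventually_at_left_real[of 0 1] by (auto elim: eventually_mono)
  moreover have "((\<lambda>r. norm (fps_nth F n) * r ^ n) \<longlongrightarrow> norm (fps_nth F n) * 1 ^ n) (at_left 1)"
    by (intro tendsto_intros)
  ultimately show ?thesis
    using tendsto_upperbound trivial_limit_at_left_real by fastforce
qed

text \<open>The real part equals (1 - |w|^2) / |1 - w|^2.\<close>

lemma Cayley_Re_pos:
  fixes w :: complex
  assumes "norm w < 1"
  shows "Re ((1 + w) / (1 - w)) > 0"
proof -
  have "w \<noteq> 1"
    using assms by auto
  moreover have "(Re w)\<^sup>2 + (Im w)\<^sup>2 < 1"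
    using assms by (metis cmod_power2 norm_ge_zero power_one power_strict_mono zero_less_numeral)
  moreover have "(1 - Re w)\<^sup>2 + (Im w)\<^sup>2 > 0"
    using calculation(1) by (auto simp: sum_power2_gt_zero_iff complex_eq_iff)
  ultimately show ?thesis
    by (simp add: Re_divide) (simp add: power2_eq_square algebra_simps)
qed

text \<open>This follows from |w + 1|^2 - |w - 1|^2 = 4 Re w.\<close>

lemma Cayley_inverse_norm_less:
  fixes w :: complex
  assumes "Re w > 0"
  shows "norm ((w - 1) / (w + 1)) < 1"
proof -
  have "(norm (w - 1))\<^sup>2 < (norm (w + 1))\<^sup>2"
    unfolding cmod_power2 using assms by (simp add: power2_eq_square algebra_simps)
  then have "norm (w - 1) < norm (w + 1)"
    using power_less_imp_less_base by fastforce
  then show ?thesis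
    by (auto simp: norm_divide divide_simps)
qed

lemma class_P_Re_pos:
  assumes "p \<in> class_P" "z \<in> \<D>"
  shows "Re (p z) > 0"
proof -
  obtain \<phi> where \<phi>: "\<phi> ` \<D> \<subseteq> \<D>" "\<forall>z\<in>\<D>. p z = (1 + \<phi> z) / (1 - \<phi> z)"
    using assms(1) by (auto simp: class_P_def)
  then have "norm (\<phi> z) < 1"
    using assms(2) by (auto simp: image_subset_iff)
  then show ?thesis
    using \<phi> assms(2) Cayley_Re_pos by simp
qed

section \<open>Rotation averages and Caratheodory's bound\<close>

lemma has_fps_expansion_rotation:
  fixes f :: "complex \<Rightarrow> complex"
  assumes "f has_fps_expansion F"
  shows "(\<lambda>z. f (c * z)) has_fps_expansion Abs_fps (\<lambda>n. c ^ n * fps_nth F n)"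
proof -
  have "(\<lambda>z. c * z) has_fps_expansion fps_const c * fps_X"
    by (intro fps_expansion_intros)
  then have "(f \<circ> (\<lambda>z. c * z)) has_fps_expansion (F oo (fps_const c * fps_X))"
    by (intro has_fps_expansion_compose assms) auto
  then show ?thesis
    by (simp add: fps_compose_linear o_def)
qed

text \<open>The sum is geometric with ratio \<open>w ^ m\<close>. This ratio is 1 exactly when
  \<open>n\<close> divides \<open>m\<close>; otherwise the sum vanishes because
  \<open>(w ^ m) ^ n = 1\<close>.\<close>

lemma sum_root_of_unity_powers:
  assumes "n \<ge> 1"
  defines "w \<equiv> exp (2 * of_real pi * \<i> / of_nat n)"
  shows "(\<Sum>j<n. (w ^ j) ^ m) = (if n dvd m then of_nat n else 0)"
proof -
  have w: "w ^ m = exp (2 * of_real pi * \<i> * of_nat m / of_nat n)" for m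
    by (simp add: w_def exp_of_nat_mult[symmetric] field_simps)
  have swap: "(w ^ j) ^ m = (w ^ m) ^ j" for j
    by (metis mult.commute power_mult)
  have "w ^ n = 1"
    using complex_root_unity_eq_1[OF assms(1), of n] w by simp
  then have "(w ^ m) ^ n = 1"
    by (metis mult.commute power_mult power_one)
  moreover have "w ^ m = 1 \<longleftrightarrow> n dvd m"
    using complex_root_unity_eq_1[OF assms(1), of m] w by simp
  ultimately show ?thesis
    by (auto simp: swap geometric_sum)
qed

theorem Caratheodory_coefficient_bound:
  assumes p: "p holomorphic_on ball 0 1" "p has_fps_expansion P" "p 0 = 1"
    and pos: "\<And>z. z \<in> ball 0 1 \<Longrightarrow> Re (p z) > 0"
    and n: "n \<ge> 1"
  shows "norm (fps_nth P n) \<le> 2"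
proof -
  define w where "w = exp (2 * of_real pi * \<i> / of_nat n)"
  define q where "q = (\<lambda>z. of_real (1 / n) * (\<Sum>j<n. p (w ^ j * z)))"
  define Q where "Q = fps_const (of_real (1 / n)) * (\<Sum>j<n. Abs_fps (\<lambda>m. (w ^ j) ^ m * fps_nth P m))"
  define h where "h = (\<lambda>z. (q z - 1) / (q z + 1))"
  define H where "H = (Q - 1) * inverse (Q + 1)"
  have norm_w: "norm (w ^ j * z) = norm z" for j z
    by (simp add: w_def norm_mult norm_power)
  have P0: "fps_nth P 0 = 1"
    using p(2,3) has_fps_expansion_imp_0_eq_fps_nth_0 by fastforce
  have Q_nth: "fps_nth Q m = (if n dvd m then fps_nth P m else 0)" for m
    using n sum_root_of_unity_powers[OF n, of m, folded w_def]
    by (simp add: Q_def fps_sum_nth sum_distrib_right[symmetric])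
  have q_exp: "q has_fps_expansion Q"
    unfolding q_def Q_def by (intro fps_expansion_intros has_fps_expansion_rotation p)
  have q_holo: "q holomorphic_on ball 0 1"
  proof -
    have "(\<lambda>z. p (w ^ j * z)) holomorphic_on ball 0 1" for j
    proof -
      have "(\<lambda>z. w ^ j * z) ` ball 0 1 \<subseteq> ball 0 1"
        using norm_w by auto
      moreover have "(\<lambda>z. w ^ j * z) holomorphic_on ball 0 1"
        by (intro holomorphic_intros)
      ultimately show ?thesis
        using holomorphic_on_compose_gen p(1) by (fastforce simp: o_def)
    qed
    then show ?thesis
      unfolding q_def by (intro holomorphic_intros)
  qed
  have q_pos: "Re (q z) > 0" if "z \<in> ball 0 1" for z
  proof -
    have "(\<Sum>j<n. Re (p (w ^ j * z))) > 0"
      using n that by (intro sum_pos pos) (auto simp: norm_w lessThan_empty_iff)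
    moreover have "Re (q z) = 1 / n * (\<Sum>j<n. Re (p (w ^ j * z)))"
      unfolding q_def by (simp add: sum_divide_distrib)
    ultimately show ?thesis
      using n by simp
  qed
  have h_bound: "norm (h z) \<le> 1" if "z \<in> ball 0 1" for z
    using Cayley_inverse_norm_less[OF q_pos[OF that]] by (simp add: h_def)
  have "q z + 1 \<noteq> 0" if "z \<in> ball 0 1" for z
    using q_pos[OF that] by (auto simp: complex_eq_iff)
  then have h_holo: "h holomorphic_on ball 0 1"
    unfolding h_def by (intro holomorphic_intros q_holo)
  have h_exp: "h has_fps_expansion H"
    unfolding h_def H_def divide_inverse
    by (intro fps_expansion_intros q_exp) (simp add: Q_nth P0)
  \<comment> \<open>The constant term 1 cancels, and averaging has removed all coefficients strictly
    between 0 and \<open>n\<close>.\<close>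
  have "Q - 1 = fps_X ^ n * fps_shift n Q"
    using n by (intro fps_ext) (auto simp: fps_X_power_mult_nth Q_nth P0 dest: nat_dvd_not_less)
  then have "fps_nth H n = fps_nth (fps_shift n Q * inverse (Q + 1)) 0"
    by (simp add: H_def mult.assoc fps_X_power_mult_nth)
  \<comment> \<open>The factor 2 is the constant term of \<open>Q + 1\<close>, so its inverse starts
    with 1/2.\<close>
  then have "fps_nth P n = 2 * fps_nth H n"
    by (simp add: Q_nth P0 fps_inverse_def mult.commute[of 2])
  then show ?thesis
    using fps_nth_bounded_on_disc[OF h_holo h_exp h_bound, of n] by (simp add: norm_mult)
qed

section \<open>The coefficient recursion\<close>

text \<open>This is the equality case of the recursion. With X the product on the right, the
  inductive step is X / m! + k X / (m+1)! = X (k + m + 1) / (m+1)!.\<close>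

lemma rising_product_sum:
  fixes k :: real
  shows "k * (\<Sum>j\<le>m. (\<Prod>\<nu><j. k + real \<nu>) / fact j) = (\<Prod>\<nu><Suc m. k + real \<nu>) / fact m"
proof (induction m)
  case (Suc m)
  define X where "X = (\<Prod>\<nu><Suc m. k + real \<nu>)"
  have "X / fact m + k * (X / fact (Suc m)) = X * (k + real (Suc m)) / fact (Suc m)"
    by (simp add: divide_simps) (simp add: algebra_simps)
  then show ?case
    using Suc unfolding sum.atMost_Suc distrib_left prod.lessThan_Suc[of _ "Suc m"] X_def by simp
qed simp

text \<open>The index is shifted by one: \<open>b n\<close> will be the norm of
  \<open>a (Suc n)\<close>. As \<open>k \<ge> 0\<close>, the bounds on earlier terms can be inserted
  into the recursion and summed by \<open>rising_product_sum\<close>.\<close>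

lemma coefficient_recursion_bound:
  fixes b :: "nat \<Rightarrow> real"
  assumes "k \<ge> 0" "b 0 \<le> 1"
    and rec: "\<And>n. real (Suc n) * b (Suc n) \<le> k * (\<Sum>j\<le>n. b j)"
  shows "b n \<le> (\<Prod>\<nu><n. k + real \<nu>) / fact n"
proof (induction n rule: less_induct)
  case (less n)
  show ?case
  proof (cases n)
    case (Suc m)
    have "real (Suc m) * b (Suc m) \<le> k * (\<Sum>j\<le>m. b j)"
      by (rule rec)
    also have "\<dots> \<le> k * (\<Sum>j\<le>m. (\<Prod>\<nu><j. k + real \<nu>) / fact j)"
      using less Suc by (intro mult_left_mono sum_mono assms) auto
    also have "\<dots> = (\<Prod>\<nu><Suc m. k + real \<nu>) / fact m"
      by (rule rising_product_sum)
    finally show ?thesis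
      unfolding Suc fact_Suc by (simp add: divide_simps mult_ac del: prod.lessThan_Suc)
  qed (use assms in simp)
qed

section \<open>Coefficients of functions of bounded radius rotation\<close>

theorem theorem2p7:
  fixes k :: real and f :: "complex \<Rightarrow> complex" and a :: "nat \<Rightarrow> complex" and n :: nat
  assumes "k \<ge> 2"
    and "f \<in> class_R k"
    and "\<forall>z\<in>\<D>. (\<lambda>m. a m * z ^ m) sums f z"
    and "n \<ge> 2"
  shows "norm (a n) \<le> 1 / fact (n - 1) * (\<Prod>\<nu>=0..n-2. (k + real \<nu>))"
proof -
  have in_disc: "eventually (\<lambda>z. z \<in> \<D>) (nhds (0::complex))"
    by (intro eventually_nhds_in_open) auto
  have f_exp: "f has_fps_expansion Abs_fps b" if "\<forall>z\<in>\<D>. (\<lambda>m. b m * z ^ m) sums f z" for b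
    using that by (intro has_fps_expansionI eventually_mono[OF in_disc]) auto
  define A where "A = Abs_fps a"
  have A: "f has_fps_expansion A"
    unfolding A_def using assms(3) by (rule f_exp)
  \<comment> \<open>Class membership only supplies some normalized sequence \<open>b\<close>;
    uniqueness of power series identifies it with the given \<open>a\<close>.\<close>
  from assms(2) obtain b where "b 0 = 0" "b 1 = 1" "\<forall>z\<in>\<D>. (\<lambda>m. b m * z ^ m) sums f z"
    by (auto simp: class_R_def class_A_def)
  then have a01: "a 0 = 0" "a 1 = 1"
    using fps_expansion_unique_complex[OF A f_exp[of b]] by (auto simp: A_def fps_eq_iff)
  have f0: "f 0 = 0"
    using has_fps_expansion_imp_0_eq_fps_nth_0[OF A] by (simp add: A_def a01)
  from assms(2) obtain p1 p2 where p: "p1 \<in> class_P" "p2 \<in> class_P"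
    and quot: "\<And>z. z \<in> \<D> \<Longrightarrow> log_deriv_quotient f z =
          complex_of_real (k / 4 + 1 / 2) * p1 z - complex_of_real (k / 4 - 1 / 2) * p2 z"
    and f_nz: "\<And>z. z \<in> \<D> - {0} \<Longrightarrow> f z \<noteq> 0"
    by (auto simp: class_R_def)
  have P_exp: "q has_fps_expansion fps_expansion q 0" if "q \<in> class_P" for q
    using that by (intro has_fps_expansion_fps_expansion[of "\<D>"]) (auto simp: class_P_def)
  have P_bound: "norm (fps_nth (fps_expansion q 0) m) \<le> 2" if "q \<in> class_P" "m \<ge> 1" for q m
    using that P_exp class_P_Re_pos
    by (intro Caratheodory_coefficient_bound[of q]) (auto simp: class_P_def)
  define Q where "Q = fps_const (complex_of_real (k / 4 + 1 / 2)) * fps_expansion p1 0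
      - fps_const (complex_of_real (k / 4 - 1 / 2)) * fps_expansion p2 0"
  define q where "q = (\<lambda>z. complex_of_real (k / 4 + 1 / 2) * p1 z - complex_of_real (k / 4 - 1 / 2) * p2 z)"
  have Q: "q has_fps_expansion Q"
    unfolding q_def Q_def by (intro fps_expansion_intros P_exp p)
  \<comment> \<open>This uses the value 1 with which \<open>log_deriv_quotient\<close> fills the
    singularity at 0.\<close>
  have Q0: "fps_nth Q 0 = 1"
    using has_fps_expansion_imp_0_eq_fps_nth_0[OF Q] quot[of 0]
    by (simp add: q_def log_deriv_quotient_def)
  have Q_bound: "norm (fps_nth Q m) \<le> k" if "m \<ge> 1" for m
  proof -
    \<comment> \<open>Both weights are nonnegative since \<open>k \<ge> 2\<close>, so they equal
      their norms, and the two bounds of 2 add up to \<open>k\<close>.\<close>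
    have "norm (fps_nth Q m) \<le> (k / 4 + 1 / 2) * norm (fps_nth (fps_expansion p1 0) m)
        + (k / 4 - 1 / 2) * norm (fps_nth (fps_expansion p2 0) m)"
      unfolding Q_def fps_sub_nth fps_mult_left_const_nth
      by (rule order_trans[OF norm_triangle_ineq4])
         (use assms(1) in \<open>simp add: norm_mult del: of_real_add of_real_diff of_real_divide\<close>)
    also have "\<dots> \<le> (k / 4 + 1 / 2) * 2 + (k / 4 - 1 / 2) * 2"
      using assms(1) that p by (intro add_mono mult_left_mono P_bound) auto
    finally show ?thesis
      by simp
  qed
  have "(\<lambda>z. z * deriv f z) has_fps_expansion fps_X * fps_deriv A"
    by (intro fps_expansion_intros A)
  moreover have "(\<lambda>z. q z * f z) has_fps_expansion Q * A"
    by (intro fps_expansion_intros A Q)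
  \<comment> \<open>The product form avoids dividing by \<open>f\<close>, which vanishes at 0; there
    both sides are 0.\<close>
  moreover have "eventually (\<lambda>z. z * deriv f z = q z * f z) (nhds 0)"
    using in_disc
  proof eventually_elim
    case (elim z)
    show ?case
    proof (cases "z = 0")
      case False
      then have "z * (deriv f z / f z) = q z"
        using quot[OF elim] by (simp add: log_deriv_quotient_def q_def)
      then show ?thesis
        using f_nz[of z] elim False by (auto simp: field_simps)
    qed (simp add: f0)
  qed
  ultimately have "fps_X * fps_deriv A = Q * A"
    using has_fps_expansion_cong fps_expansion_unique_complex by metis
  then have "fps_X * fps_deriv A = A * Q"
    by (simp add: mult.commute)
  then have "fps_nth (fps_X * fps_deriv A) m = fps_nth (A * Q) m" for m
    by simp
  moreover have "fps_nth (fps_X * fps_deriv A) m = of_nat m * a m" for m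
    by (cases m) (simp_all add: A_def)
  ultimately have coeff: "of_nat m * a m = (\<Sum>j=0..m. a j * fps_nth Q (m - j))" for m
    by (simp add: A_def fps_mult_nth)
  have rec: "real (Suc m) * norm (a (Suc (Suc m))) \<le> k * (\<Sum>j\<le>m. norm (a (Suc j)))" for m
  proof -
    \<comment> \<open>The term \<open>j = 0\<close> drops out since \<open>a 0 = 0\<close>. The last
      term is \<open>a (Suc (Suc m))\<close> itself, as \<open>Q\<close> starts with 1; moving it to
      the left lowers the factor from m + 2 to m + 1.\<close>
    have "of_nat (Suc (Suc m)) * a (Suc (Suc m)) =
        (\<Sum>j\<le>m. a (Suc j) * fps_nth Q (Suc m - j)) + a (Suc (Suc m))"
      unfolding coeff atLeast0AtMost sum.atMost_Suc_shift[of _ "Suc m"] by (simp add: a01 Q0)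
    then have "of_nat (Suc m) * a (Suc (Suc m)) = (\<Sum>j\<le>m. a (Suc j) * fps_nth Q (Suc m - j))"
      by (simp add: algebra_simps)
    then have "real (Suc m) * norm (a (Suc (Suc m))) = norm (\<Sum>j\<le>m. a (Suc j) * fps_nth Q (Suc m - j))"
      by (metis norm_mult norm_of_nat)
    also have "\<dots> \<le> (\<Sum>j\<le>m. norm (a (Suc j)) * k)"
      by (intro sum_norm_le) (auto simp: norm_mult intro!: mult_left_mono Q_bound)
    finally show ?thesis
      by (simp add: sum_distrib_left mult.commute)
  qed
  have "norm (a (Suc (n - 1))) \<le> (\<Prod>\<nu><n - 1. k + real \<nu>) / fact (n - 1)"
    using assms(1) a01 rec by (intro coefficient_recursion_bound[of k "\<lambda>m. norm (a (Suc m))"]) auto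
  moreover have "{..<n - 1} = {0..n - 2}"
    using assms(4) by auto
  ultimately show ?thesis
    using assms(4) by simp
qed

end
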